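(* Let $\alpha\in(0,1]$ be a constant. Consider running RAC on $n$ data points, and assume that in each round at least a fraction $\alpha$ of the current clusters (nodes) are merged. Then, in the cost model described in the context, RAC runs in expected time $O(n^2)$ (with implied constant depending only on $\alpha$).
   Context: RAC (Reciprocal Agglomerative Clustering) starts with each of the $n$ data points in its own singleton cluster and proceeds in rounds; in each round, all pairs of reciprocal nearest neighbors in the current set of clusters (pairs each of which is the other's nearest cluster under the linkage function) are simultaneously merged pairwise; it stops when one cluster remains. Thus if a round starts with $N$ clusters of which $\alpha' N$ take part in a merge, $\alpha' N/2$ pairs are merged and $(1-\alpha'/2)N$ clusters remain. Cost model: in a round that starts with $N$ clusters, finding all reciprocal nearest neighbors costs $O(N)$; merging each pair costs $O(N)$; and afterwards, updating the nearest neighbor of each remaining cluster by a linear scan costs $O(N')$ per cluster, i.e. $O(N'^2)$ in total, where $N'$ is the number of remaining clusters. The running time is the sum of these costs over all rounds. (Expectation is over any randomness in the input; the assumption on $\alpha$ holds in every round.) *)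

theory Defs
  imports "HOL-Probability.Probability"
begin

text \<open>
  The data points are identified with their indices \<open>0, \<dots>, n - 1\<close>, so that a cluster is a set of
  indices; the linkage is an arbitrary real-valued function on pairs of clusters.

  An execution records the input (the linkage), the nearest neighbours that are used (this matters
  only in case of ties), and the actual costs of the individual steps.  All of these may depend on
  the current set of clusters.  Since no set of clusters occurs in two different rounds of a run
  in which every round merges something, this covers every dependence on the round as well.
\<close>

type_synonym cluster = "nat set"

record rac_exec =
  linkage :: "cluster \<Rightarrow> cluster \<Rightarrow> real"
  nearest :: "cluster set \<Rightarrow> cluster \<Rightarrow> cluster"
  find_cost :: "cluster set \<Rightarrow> ennreal"
  merge_cost :: "cluster set \<Rightarrow> cluster set \<Rightarrow> ennreal"
    \<comment> \<open>first argument: clusters at the start of the round; second: the two-element set to be merged\<close>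
  update_cost :: "cluster set \<Rightarrow> cluster \<Rightarrow> ennreal"
    \<comment> \<open>first argument: clusters remaining after the merges of the round\<close>

definition nearest_neighbours :: "rac_exec \<Rightarrow> cluster set \<Rightarrow> bool" where
  "nearest_neighbours e P \<longleftrightarrow>
     (\<forall>C\<in>P. is_arg_min (linkage e C) (\<lambda>D. D \<in> P - {C}) (nearest e P C))"

definition reciprocal_pairs :: "rac_exec \<Rightarrow> cluster set \<Rightarrow> cluster set set" where
  "reciprocal_pairs e P =
     {{C, D} | C D. C \<in> P \<and> D \<in> P \<and> C \<noteq> D \<and> nearest e P C = D \<and> nearest e P D = C}"

definition merged_clusters :: "rac_exec \<Rightarrow> cluster set \<Rightarrow> cluster set" where
  "merged_clusters e P = \<Union> (reciprocal_pairs e P)"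

definition rac_round :: "rac_exec \<Rightarrow> cluster set \<Rightarrow> cluster set" where
  "rac_round e P = (P - merged_clusters e P) \<union> \<Union> ` reciprocal_pairs e P"

text \<open>The clusters after \<open>k\<close> rounds; the sequence stays constant once the algorithm has stopped.\<close>

primrec rac_clusters :: "nat \<Rightarrow> rac_exec \<Rightarrow> nat \<Rightarrow> cluster set" where
  "rac_clusters n e 0 = (\<lambda>i. {i}) ` {..<n}"
| "rac_clusters n e (Suc k) =
     (let P = rac_clusters n e k in if 1 < card P then rac_round e P else P)"

definition round_starts :: "nat \<Rightarrow> rac_exec \<Rightarrow> cluster set set" where
  "round_starts n e = {P. \<exists>k. P = rac_clusters n e k \<and> 1 < card P}"

definition rac_execution :: "nat \<Rightarrow> rac_exec \<Rightarrow> bool" where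
  "rac_execution n e \<longleftrightarrow> (\<forall>P\<in>round_starts n e. nearest_neighbours e P)"

definition merges_fraction :: "real \<Rightarrow> nat \<Rightarrow> rac_exec \<Rightarrow> bool" where
  "merges_fraction \<alpha> n e \<longleftrightarrow>
     (\<forall>P\<in>round_starts n e. \<alpha> * real (card P) \<le> real (card (merged_clusters e P)))"

text \<open>The constant \<open>c\<close> is a common value for the constants hidden in the cost model's O-terms.\<close>

definition obeys_cost_model :: "real \<Rightarrow> nat \<Rightarrow> rac_exec \<Rightarrow> bool" where
  "obeys_cost_model c n e \<longleftrightarrow>
     (\<forall>P\<in>round_starts n e.
        find_cost e P \<le> ennreal (c * real (card P)) \<and>
        (\<forall>p\<in>reciprocal_pairs e P. merge_cost e P p \<le> ennreal (c * real (card P))) \<and>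
        (\<forall>C\<in>rac_round e P.
           update_cost e (rac_round e P) C \<le> ennreal (c * real (card (rac_round e P)))))"

definition round_cost :: "rac_exec \<Rightarrow> cluster set \<Rightarrow> ennreal" where
  "round_cost e P =
     find_cost e P + (\<Sum>p\<in>reciprocal_pairs e P. merge_cost e P p)
       + (\<Sum>C\<in>rac_round e P. update_cost e (rac_round e P) C)"

text \<open>A series over all rounds in \<open>[0, \<infinity>]\<close>, so that termination is not presupposed.\<close>

definition running_time :: "nat \<Rightarrow> rac_exec \<Rightarrow> ennreal" where
  "running_time n e =
     (\<Sum>k. if 1 < card (rac_clusters n e k) then round_cost e (rac_clusters n e k) else 0)"

end

(* Since nearest e P is a function, reciprocal pairs are disjoint, so a round merging m clusters
   removes exactly m/2 of them. Hence the number of clusters shrinks by the factor 1 - \<alpha>/2 in every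
   round, while a round on N clusters costs at most 3 c N^2; the costs are dominated by a geometric
   series. This holds for every single execution, and the expectation is then bounded
   by monotonicity. *)
theory Submission
  imports Defs
begin

lemma finite_reciprocal_pairs:
  assumes "finite P"
  shows "finite (reciprocal_pairs e P)"
  by (rule finite_subset[of _ "Pow P"]) (use assms in \<open>auto simp: reciprocal_pairs_def\<close>)

lemma merged_clusters_subset: "merged_clusters e P \<subseteq> P"
  by (auto simp: merged_clusters_def reciprocal_pairs_def)

text \<open>Because \<open>nearest e P\<close> is a function, a pair is determined by either of its
  elements, however ties are broken; hence two pairs sharing a cluster coincide.\<close>

lemma reciprocal_pair_eq:
  assumes "p \<in> reciprocal_pairs e P" and "C \<in> p"
  shows "p = {C, nearest e P C}"
proof -
  obtain A B where "p = {A, B}" "nearest e P A = B" "nearest e P B = A"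
    using assms(1) unfolding reciprocal_pairs_def by blast
  then show ?thesis
    using assms(2) by (cases "C = A") (simp_all add: insert_commute)
qed

text \<open>The reciprocal pairs partition the merged clusters into blocks of size two.\<close>

lemma card_merged_clusters:
  assumes "finite P"
  shows "card (merged_clusters e P) = 2 * card (reciprocal_pairs e P)"
proof -
  have "2 * card (reciprocal_pairs e P) = card (\<Union> (reciprocal_pairs e P))"
  proof (rule card_partition)
    show "finite (reciprocal_pairs e P)"
      using assms by (rule finite_reciprocal_pairs)
    show "finite (\<Union> (reciprocal_pairs e P))"
      using merged_clusters_subset[of e P] assms
      by (auto simp: merged_clusters_def intro: finite_subset)
    show "card p = 2" if "p \<in> reciprocal_pairs e P" for p
      using that unfolding reciprocal_pairs_def card_2_iff by blast
    show "p \<inter> q = {}"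
      if "p \<in> reciprocal_pairs e P" "q \<in> reciprocal_pairs e P" "p \<noteq> q" for p q
    proof (rule ccontr)
      assume "p \<inter> q \<noteq> {}"
      then obtain C where "C \<in> p" "C \<in> q"
        by blast
      then show False
        using reciprocal_pair_eq that by metis
    qed
  qed
  then show ?thesis
    by (simp add: merged_clusters_def)
qed

lemma card_reciprocal_pairs_le:
  assumes "finite P"
  shows "card (reciprocal_pairs e P) \<le> card P"
  using card_merged_clusters[OF assms, of e] card_mono[OF assms merged_clusters_subset[of e P]]
  by simp

lemma finite_rac_round:
  assumes "finite P"
  shows "finite (rac_round e P)"
  using assms by (simp add: rac_round_def finite_reciprocal_pairs)

text \<open>Each pair gives up two clusters and contributes at most one. Since \<open>P\<close> is
  an arbitrary finite set of clusters, unions of pairs may collide with each other or with surviving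
  clusters; this only lowers the count, whence an inequality.\<close>

lemma card_rac_round_le:
  assumes "finite P"
  shows "card (rac_round e P) + card (reciprocal_pairs e P) \<le> card P"
proof -
  let ?R = "reciprocal_pairs e P" and ?M = "merged_clusters e P"
  have "card (rac_round e P) \<le> card (P - ?M) + card (\<Union> ` ?R)"
    unfolding rac_round_def by (rule card_Un_le)
  also have "card (\<Union> ` ?R) \<le> card ?R"
    using assms by (intro card_image_le finite_reciprocal_pairs)
  also have "card (P - ?M) = card P - card ?M"
    using assms merged_clusters_subset by (intro card_Diff_subset) (auto intro: finite_subset)
  finally show ?thesis
    using card_merged_clusters[OF assms, of e] card_mono[OF assms merged_clusters_subset[of e P]]
    by simp
qed

lemma card_rac_round_shrinks:
  assumes "finite P" and "\<alpha> * real (card P) \<le> real (card (merged_clusters e P))"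
  shows "real (card (rac_round e P)) \<le> (1 - \<alpha> / 2) * real (card P)"
proof -
  have "real (card (rac_round e P)) + real (card (reciprocal_pairs e P)) \<le> real (card P)"
    using card_rac_round_le[OF assms(1), of e] by linarith
  then show ?thesis
    using assms card_merged_clusters[OF assms(1), of e] by (simp add: algebra_simps)
qed

text \<open>Iterates the shrinking factor. The bound is restricted to active rounds because the
  sequence becomes constant after stopping while the right-hand side may keep decaying.\<close>

lemma card_rac_clusters_le:
  assumes "merges_fraction \<alpha> n e" and "\<alpha> \<le> 2" and "1 < card (rac_clusters n e k)"
  shows "real (card (rac_clusters n e k)) \<le> (1 - \<alpha> / 2) ^ k * real n"
  using assms(3)
proof (induction k)
  case 0
  then show ?case
    by (simp add: card_image)
next
  case (Suc k)
  let ?P = "rac_clusters n e k"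
  \<comment> \<open>A stopped run stays unchanged, so activity at \<open>Suc k\<close> forces
    activity at \<open>k\<close>.\<close>
  have active: "1 < card ?P"
    using Suc.prems by (auto simp: Let_def split: if_splits)
  \<comment> \<open>An infinite set has \<open>card\<close> equal to 0.\<close>
  then have "finite ?P"
    by (metis card.infinite not_less_zero)
  moreover have "\<alpha> * real (card ?P) \<le> real (card (merged_clusters e ?P))"
    using assms(1) active by (auto simp: merges_fraction_def round_starts_def)
  ultimately have "real (card (rac_round e ?P)) \<le> (1 - \<alpha> / 2) * real (card ?P)"
    by (rule card_rac_round_shrinks)
  also have "\<dots> \<le> (1 - \<alpha> / 2) * ((1 - \<alpha> / 2) ^ k * real n)"
    using Suc.IH[OF active] assms(2) by (intro mult_left_mono) auto
  finally show ?case
    using active by (simp add: mult.assoc)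
qed

lemma sum_le_card_mult_ennreal:
  assumes "\<And>x. x \<in> A \<Longrightarrow> f x \<le> ennreal b" and "card A \<le> N" and "0 \<le> b"
  shows "sum f A \<le> ennreal (real N * b)"
proof -
  have "sum f A \<le> of_nat (card A) * ennreal b"
    using assms(1) by (rule sum_bounded_above)
  also have "\<dots> = ennreal (real (card A) * b)"
    using assms(3) by (simp add: ennreal_of_nat_eq_real_of_nat ennreal_mult)
  also have "\<dots> \<le> ennreal (real N * b)"
    using assms(2,3) by (intro ennreal_leI mult_right_mono) auto
  finally show ?thesis .
qed

text \<open>With N clusters at the start, each of the three cost terms is at most N * (c * N): one
  search, at most N merges, and at most N updates, each costing at most c * N.\<close>

lemma round_cost_le:
  assumes "obeys_cost_model c n e" and "P \<in> round_starts n e" and "0 \<le> c"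
  shows "round_cost e P \<le> ennreal (3 * c * (real (card P))\<^sup>2)"
proof -
  let ?N = "card P" and ?Q = "rac_round e P"
  have N: "1 < ?N"
    using assms(2) by (auto simp: round_starts_def)
  then have fin: "finite P"
    by (metis card.infinite not_less_zero)
  have Q: "card ?Q \<le> ?N"
    using card_rac_round_le[OF fin, of e] by simp
  have mono: "c * real (card ?Q) \<le> c * real ?N"
    using Q assms(3) by (intro mult_left_mono) auto
  \<comment> \<open>The factor 1 is written out so that it can be raised to N by
    monotonicity.\<close>
  have "find_cost e P \<le> ennreal (1 * (c * real ?N))"
    using assms(1,2) by (auto simp: obeys_cost_model_def)
  also have "\<dots> \<le> ennreal (real ?N * (c * real ?N))"
    using N assms(3) by (intro ennreal_leI mult_right_mono) auto
  finally have find: "find_cost e P \<le> ennreal (real ?N * (c * real ?N))" .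
  have merge: "(\<Sum>p\<in>reciprocal_pairs e P. merge_cost e P p) \<le> ennreal (real ?N * (c * real ?N))"
    using assms card_reciprocal_pairs_le[OF fin, of e]
    by (intro sum_le_card_mult_ennreal) (auto simp: obeys_cost_model_def)
  have update: "(\<Sum>C\<in>?Q. update_cost e ?Q C) \<le> ennreal (real ?N * (c * real ?N))"
  proof (intro sum_le_card_mult_ennreal)
    fix C assume "C \<in> ?Q"
    then have "update_cost e ?Q C \<le> ennreal (c * real (card ?Q))"
      using assms(1,2) by (auto simp: obeys_cost_model_def)
    also have "\<dots> \<le> ennreal (c * real ?N)"
      using mono by (rule ennreal_leI)
    finally show "update_cost e ?Q C \<le> ennreal (c * real ?N)" .
  qed (use Q assms(3) in auto)
  have "round_cost e P \<le> ennreal (real ?N * (c * real ?N)) + ennreal (real ?N * (c * real ?N))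
      + ennreal (real ?N * (c * real ?N))"
    unfolding round_cost_def by (intro add_mono find merge update)
  also have "\<dots> = ennreal (3 * c * (real ?N)\<^sup>2)"
    using assms(3) by (simp add: ennreal_plus[symmetric] power2_eq_square algebra_simps
        del: ennreal_plus)
  finally show ?thesis .
qed

lemma running_time_le:
  assumes "0 < \<alpha>" and "\<alpha> \<le> 2" and "0 \<le> c"
    and "obeys_cost_model c n e" and "merges_fraction \<alpha> n e"
  shows "running_time n e \<le> ennreal (6 / \<alpha> * c * (real n)\<^sup>2)"
proof -
  let ?q = "1 - \<alpha> / 2"
  have q: "0 \<le> ?q" "?q < 1"
    using assms(1,2) by auto
  have "(if 1 < card (rac_clusters n e k) then round_cost e (rac_clusters n e k) else 0)
      \<le> ennreal (3 * c * (real n)\<^sup>2 * ?q ^ k)" for k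
  proof (cases "1 < card (rac_clusters n e k)")
    case True
    let ?P = "rac_clusters n e k"
    have "(real (card ?P))\<^sup>2 \<le> (?q ^ k * real n)\<^sup>2"
      using card_rac_clusters_le[OF assms(5,2) True] by (intro power_mono) auto
    also have "\<dots> = (?q ^ k)\<^sup>2 * (real n)\<^sup>2"
      by (rule power_mult_distrib)
    \<comment> \<open>The squared ratio is weakened to \<open>?q ^ k\<close>, valid as
      \<open>?q\<close> lies in [0, 1); this only affects the constant and gives a simpler geometric
      series.\<close>
    also have "\<dots> \<le> ?q ^ k * (real n)\<^sup>2"
      using q by (intro mult_right_mono)
        (auto simp: power2_eq_square intro!: mult_left_le power_le_one)
    finally have shrink: "3 * c * (real (card ?P))\<^sup>2 \<le> 3 * c * (?q ^ k * (real n)\<^sup>2)"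
      using assms(3) by (intro mult_left_mono) auto
    have "round_cost e ?P \<le> ennreal (3 * c * (real (card ?P))\<^sup>2)"
      using True assms(3,4) by (intro round_cost_le) (auto simp: round_starts_def)
    also have "\<dots> \<le> ennreal (3 * c * (?q ^ k * (real n)\<^sup>2))"
      using shrink by (rule ennreal_leI)
    finally show ?thesis
      using True by (simp add: mult_ac)
  qed simp
  then have "running_time n e \<le> (\<Sum>k. ennreal (3 * c * (real n)\<^sup>2 * ?q ^ k))"
    unfolding running_time_def by (intro suminf_le) auto
  also have "\<dots> = ennreal (6 / \<alpha> * c * (real n)\<^sup>2)"
  proof (rule suminf_ennreal_eq)
    show "0 \<le> 3 * c * (real n)\<^sup>2 * ?q ^ k" for k
      using q assms(3) by simp
    \<comment> \<open>Here 1 / (1 - \<open>?q\<close>) is 2 / \<alpha>, which together with the 3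
      from \<open>round_cost_le\<close> yields 6 / \<alpha>.\<close>
    have "(\<lambda>k. ?q ^ k) sums (1 / (1 - ?q))"
      using q by (intro geometric_sums) auto
    then have "(\<lambda>k. 3 * c * (real n)\<^sup>2 * ?q ^ k) sums (3 * c * (real n)\<^sup>2 * (1 / (1 - ?q)))"
      by (rule sums_mult)
    then show "(\<lambda>k. 3 * c * (real n)\<^sup>2 * ?q ^ k) sums (6 / \<alpha> * c * (real n)\<^sup>2)"
      by (simp add: mult_ac)
  qed
  finally show ?thesis .
qed

theorem theorem7:
  fixes \<alpha> :: real
  assumes "0 < \<alpha>" and "\<alpha> \<le> 1"
  shows "\<exists>K::real. \<forall>(c::real) (n::nat) (M :: rac_exec measure).
           c \<ge> 0 \<longrightarrow> prob_space M \<longrightarrow>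
           (AE e in M. rac_execution n e \<and> obeys_cost_model c n e \<and> merges_fraction \<alpha> n e) \<longrightarrow>
           (\<integral>\<^sup>+ e. running_time n e \<partial>M) \<le> ennreal (K * c * (real n)\<^sup>2)"
\<comment> \<open>The witness is the constant of \<open>running_time_le\<close>, which is
  independent of \<open>c\<close>, \<open>n\<close> and \<open>M\<close>.\<close>
proof (intro exI[of _ "6 / \<alpha>"] allI impI)
  fix c :: real and n :: nat and M :: "rac_exec measure"
  assume c: "0 \<le> c" and M: "prob_space M"
    and ae: "AE e in M. rac_execution n e \<and> obeys_cost_model c n e \<and> merges_fraction \<alpha> n e"
  have "(\<integral>\<^sup>+ e. running_time n e \<partial>M) \<le> (\<integral>\<^sup>+ e. ennreal (6 / \<alpha> * c * (real n)\<^sup>2) \<partial>M)"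
    by (rule nn_integral_mono_AE, rule AE_mp[OF ae])
      (use running_time_le[of \<alpha> c n] assms c in auto)
  \<comment> \<open>A constant integrates to itself because \<open>M\<close> has total mass
    1.\<close>
  also have "\<dots> = ennreal (6 / \<alpha> * c * (real n)\<^sup>2)"
    using M by (simp add: prob_space.emeasure_space_1)
  finally show "(\<integral>\<^sup>+ e. running_time n e \<partial>M) \<le> ennreal (6 / \<alpha> * c * (real n)\<^sup>2)" .
qed

end
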